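(* Let $1\le\ell\le m$ be integers and consider the $\ell$th-to-$m$th last-success problem in an infinite sequence $X_1,X_2,\dots$ of independent Bernoulli trials with success probabilities $p_k=\mathbb{P}(X_k=1)\in[0,1)$. Suppose $\sum_k p_k<\infty$ and that zero payoff is awarded for never stopping. Then an optimal rule exists, and the optimal strategy is to stop at the first success, if any, occurring on or after index $$l^*=\min\{j\in\mathbb{N}: e_{m-1}(j)\le e_{\ell}(j)\}.$$ The optimal value of the problem is $u_m(l^*;\ell)$.
   Context: In the $\ell$th-to-$m$th last-success problem one chooses a stopping rule $\tau$ (nonanticipating with respect to the filtration generated by the trials, possibly $\tau=\infty$), stopping on a success, so as to maximise the probability that $\ell\le\sum_{j\ge\tau}X_j\le m$, i.e. that the selected success is one of the $\ell$th, $(\ell+1)$th, ..., $m$th last successes. Let $r_k=p_k/(1-p_k)$. For $k\in\mathbb{N}$ let $e_0(k)=1$ and, for $i\ge 1$, $e_i(k)=\sum_{k\le t_1<\cdots<t_i}r_{t_1}\cdots r_{t_i}$ (the $i$th elementary symmetric function of $r_k,r_{k+1},\dots$). Let $s_0(k)=\prod_{j\ge k}(1-p_j)$ and $s_i(k)=s_0(k)e_i(k)$, the probability of exactly $i$ successes among trials $k,k+1,\dots$, and let $u_m(k;\ell)=\sum_{i=\ell}^m s_i(k)$.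
   Formalization: The printed index formula is false (for m = l+1 it always gives l* = 1, which need not be optimal; for l = m = 1 the set can be empty); the formal statement uses l* = min{j : e_m(j+1) ≤ e_{l-1}(j+1)} instead. *)

theory Defs
  imports "HOL-Probability.Probability" "HOL-Library.Extended_Nat"
begin

text \<open>Trials are indexed by the positive integers; the entries at index \<open>0\<close> of
  \<open>p\<close> and \<open>X\<close> are never used.\<close>

definition odds :: "(nat \<Rightarrow> real) \<Rightarrow> nat \<Rightarrow> real" where
  "odds p k = p k / (1 - p k)"

text \<open>Increasing tuples \<open>k \<le> t\<^sub>1 < \<dots> < t\<^sub>i\<close> are encoded as the \<open>i\<close>-element subsets of
  \<open>{k..}\<close>; for \<open>i = 0\<close> the only subset is empty and the value is \<open>1\<close>.\<close>

definition elem_sym :: "(nat \<Rightarrow> real) \<Rightarrow> nat \<Rightarrow> nat \<Rightarrow> real" where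
  "elem_sym p i k =
     (\<Sum>\<^sub>\<infinity>T\<in>{T. T \<subseteq> {k..} \<and> finite T \<and> card T = i}. \<Prod>t\<in>T. odds p t)"

definition succ_prob :: "(nat \<Rightarrow> real) \<Rightarrow> nat \<Rightarrow> nat \<Rightarrow> real" where
  "succ_prob p i k = (\<Prod>j. 1 - p (k + j)) * elem_sym p i k"

definition u_val :: "(nat \<Rightarrow> real) \<Rightarrow> nat \<Rightarrow> nat \<Rightarrow> nat \<Rightarrow> real" where
  "u_val p m k l = (\<Sum>i=l..m. succ_prob p i k)"

text \<open>The history up to time \<open>t\<close>. The index set is \<^typ>\<open>enat\<close> because stopping rules may
  take the value \<open>\<infinity>\<close>.\<close>

definition trial_filtration ::
    "'a measure \<Rightarrow> (nat \<Rightarrow> 'a \<Rightarrow> bool) \<Rightarrow> enat \<Rightarrow> 'a measure" where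
  "trial_filtration M X t =
     sigma (space M) {{\<omega>\<in>space M. X j \<omega>} | j. 1 \<le> j \<and> enat j \<le> t}"

definition stopping_rules ::
    "'a measure \<Rightarrow> (nat \<Rightarrow> 'a \<Rightarrow> bool) \<Rightarrow> ('a \<Rightarrow> enat) set" where
  "stopping_rules M X =
     {\<tau>. stopping_time (trial_filtration M X) \<tau> \<and>
         (\<forall>\<omega>\<in>space M. \<forall>n. \<tau> \<omega> = enat n \<longrightarrow> 1 \<le> n \<and> X n \<omega>)}"

text \<open>Never stopping contributes nothing to the winning event, i.e. has payoff zero.
  Finiteness is required explicitly because \<^const>\<open>card\<close> is \<open>0\<close> on infinite sets.\<close>

definition win_prob ::
    "'a measure \<Rightarrow> (nat \<Rightarrow> 'a \<Rightarrow> bool) \<Rightarrow> nat \<Rightarrow> nat \<Rightarrow> ('a \<Rightarrow> enat) \<Rightarrow> real" where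
  "win_prob M X l m \<tau> =
     measure M {\<omega>\<in>space M. \<exists>n. \<tau> \<omega> = enat n \<and> finite {j. n \<le> j \<and> X j \<omega>} \<and>
                  l \<le> card {j. n \<le> j \<and> X j \<omega>} \<and> card {j. n \<le> j \<and> X j \<omega>} \<le> m}"

definition optimal_rule ::
    "'a measure \<Rightarrow> (nat \<Rightarrow> 'a \<Rightarrow> bool) \<Rightarrow> nat \<Rightarrow> nat \<Rightarrow> ('a \<Rightarrow> enat) \<Rightarrow> bool" where
  "optimal_rule M X l m \<tau> \<longleftrightarrow>
     \<tau> \<in> stopping_rules M X \<and>
     (\<forall>\<sigma>\<in>stopping_rules M X. win_prob M X l m \<sigma> \<le> win_prob M X l m \<tau>)"

definition optimal_value ::
    "'a measure \<Rightarrow> (nat \<Rightarrow> 'a \<Rightarrow> bool) \<Rightarrow> nat \<Rightarrow> nat \<Rightarrow> real" where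
  "optimal_value M X l m = (SUP \<tau>\<in>stopping_rules M X. win_prob M X l m \<tau>)"

definition first_success_from :: "(nat \<Rightarrow> 'a \<Rightarrow> bool) \<Rightarrow> nat \<Rightarrow> 'a \<Rightarrow> enat" where
  "first_success_from X k \<omega> = (INF j\<in>{j. k \<le> j \<and> X j \<omega>}. enat j)"

text \<open>Stopping at a success at time \<open>j\<close> wins iff the trials after \<open>j\<close> contain between
  \<open>l - 1\<close> and \<open>m - 1\<close> successes; stopping at the next success instead wins iff they contain
  between \<open>l\<close> and \<open>m\<close>. The two winning probabilities differ by
  \<open>succ_prob p (l - 1) (j + 1) - succ_prob p m (j + 1)\<close>, which is where the inequality
  below comes from. The formula \<open>e\<^bsub>m-1\<^esub>(j) \<le> e\<^bsub>l\<^esub>(j)\<close>, with all three indices shifted by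
  one, is incorrect: for \<open>m = l + 1\<close> it holds for every \<open>j\<close>.\<close>

definition threshold_set :: "(nat \<Rightarrow> real) \<Rightarrow> nat \<Rightarrow> nat \<Rightarrow> nat set" where
  "threshold_set p l m = {j. 1 \<le> j \<and> elem_sym p m (j + 1) \<le> elem_sym p (l - 1) (j + 1)}"

definition opt_index :: "(nat \<Rightarrow> real) \<Rightarrow> nat \<Rightarrow> nat \<Rightarrow> nat" where
  "opt_index p l m = (LEAST j. j \<in> threshold_set p l m)"

end

theory Submission
  imports Defs
begin

text \<open>Let \<open>w(k)\<close> be the probability of winning by stopping on a success at time \<open>k\<close> and \<open>u(k)\<close>
  that of winning with the first success from \<open>k\<close> on. Then \<open>u(k) = (1 - p\<^sub>k) u(k+1) + p\<^sub>k w(k)\<close>, and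
  \<open>k\<close> lies in the threshold set iff \<open>u(k+1) \<le> w(k)\<close>. By log-concavity of the elementary symmetric
  functions the threshold set is upward closed, so the problem is monotone. Hence
  \<open>V(k) = u(max k l\<^sup>*)\<close> satisfies the optimality inequality, and for every stopping rule \<open>\<tau>\<close> the
  quantity \<open>\<Sum>\<^bsub>k<n\<^esub> P(\<tau> = k) w(k) + P(\<tau> \<ge> n) V(n)\<close> is nonincreasing in \<open>n\<close>, which bounds the
  winning probability of \<open>\<tau>\<close> by \<open>V(1) = u(l\<^sup>*)\<close>.\<close>


section \<open>Elementary symmetric polynomials on finite sets and their log-concavity\<close>

text \<open>A finite counterpart of \<open>elem_sym\<close>, open to induction on the set. The
  infinite version is later recovered as the limit over the windows \<open>{k..<n}\<close>.\<close>

definition esym :: "('b \<Rightarrow> real) \<Rightarrow> 'b set \<Rightarrow> nat \<Rightarrow> real" where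
  "esym r S i = (\<Sum>T | T \<subseteq> S \<and> card T = i. \<Prod>t\<in>T. r t)"

lemma esym_0:
  assumes "finite S"
  shows "esym r S 0 = 1"
proof -
  have "{T. T \<subseteq> S \<and> card T = 0} = {{}}"
    using assms by (auto dest: finite_subset)
  then show ?thesis by (simp add: esym_def)
qed

lemma esym_empty_Suc: "esym r {} (Suc i) = 0"
proof -
  have "{T::'b set. T \<subseteq> {} \<and> card T = Suc i} = {}" by auto
  then show ?thesis by (simp add: esym_def)
qed

text \<open>Split the subsets by whether they contain \<open>a\<close>; removing \<open>a\<close>
  matches those that do with the \<open>i\<close>-element subsets of \<open>S\<close>.\<close>

lemma esym_insert_Suc:
  assumes S: "finite S" and a: "a \<notin> S"
  shows "esym r (insert a S) (Suc i) = esym r S (Suc i) + r a * esym r S i"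
proof -
  let ?P = "\<lambda>i. {T. T \<subseteq> S \<and> card T = i}"
  have fin: "finite (?P i)" for i
    by (rule finite_subset[of _ "Pow S"]) (use S in auto)
  have eq: "{T. T \<subseteq> insert a S \<and> card T = Suc i} = ?P (Suc i) \<union> insert a ` ?P i"
  proof (intro equalityI subsetI)
    fix T assume "T \<in> {T. T \<subseteq> insert a S \<and> card T = Suc i}"
    then have T: "T \<subseteq> insert a S" "card T = Suc i" by auto
    then have fT: "finite T" using S finite_subset by blast
    show "T \<in> ?P (Suc i) \<union> insert a ` ?P i"
    proof (cases "a \<in> T")
      case True
      then have "T - {a} \<in> ?P i" using T fT by auto
      then have "insert a (T - {a}) \<in> insert a ` ?P i" by (rule imageI)
      then show ?thesis using True by (simp add: insert_absorb)
    qed (use T in auto)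
  next
    fix T assume "T \<in> ?P (Suc i) \<union> insert a ` ?P i"
    moreover have "card (insert a U) = Suc (card U)" if "U \<subseteq> S" for U
      using that a S finite_subset[of U S] by (metis card_insert_disjoint subsetD)
    ultimately show "T \<in> {T. T \<subseteq> insert a S \<and> card T = Suc i}" by auto
  qed
  have inj: "inj_on (insert a) (?P i)"
    using a by (auto simp: inj_on_def)
  have "(\<Sum>T\<in>insert a ` ?P i. \<Prod>t\<in>T. r t) = (\<Sum>T\<in>?P i. r a * (\<Prod>t\<in>T. r t))"
    unfolding sum.reindex[OF inj]
  proof (intro sum.cong refl)
    fix T assume T: "T \<in> ?P i"
    then have "finite T" "a \<notin> T" using S a finite_subset[of T S] by auto
    then show "((\<lambda>T. \<Prod>t\<in>T. r t) \<circ> insert a) T = r a * (\<Prod>t\<in>T. r t)" by simp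
  qed
  moreover have "?P (Suc i) \<inter> insert a ` ?P i = {}" using a by auto
  ultimately show ?thesis
    unfolding esym_def eq using fin by (simp add: sum.union_disjoint sum_distrib_left)
qed

lemma esym_nonneg:
  assumes "\<And>s. s \<in> S \<Longrightarrow> 0 \<le> r s"
  shows "0 \<le> esym r S i"
  unfolding esym_def using assms by (intro sum_nonneg prod_nonneg) auto

text \<open>Every product over an \<open>(i+1)\<close>-element subset already occurs when the
  right-hand side is multiplied out, and the other terms are nonnegative. The bound later gives both
  summability and smallness of tails.\<close>

lemma esym_Suc_le:
  assumes "finite S" "\<And>s. s \<in> S \<Longrightarrow> 0 \<le> r s"
  shows "esym r S (Suc i) \<le> sum r S * esym r S i"
  using assms
proof (induction S arbitrary: i rule: finite_induct)
  case (insert a S)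
  have nn: "0 \<le> esym r S i" "0 \<le> r a" "0 \<le> sum r S" for i
    using insert.prems by (auto intro: esym_nonneg sum_nonneg)
  have IH: "esym r S (Suc i) \<le> sum r S * esym r S i" for i
    using insert by auto
  have "esym r (insert a S) (Suc i) \<le> sum r (insert a S) * esym r S i"
    using IH[of i] insert.hyps by (simp add: esym_insert_Suc algebra_simps)
  also have "esym r S i \<le> esym r (insert a S) i"
    using insert.hyps nn by (cases i) (auto simp: esym_0 esym_insert_Suc)
  then have "sum r (insert a S) * esym r S i \<le> sum r (insert a S) * esym r (insert a S) i"
    using insert.hyps nn by (intro mult_left_mono) auto
  finally show ?case .
qed (simp add: esym_empty_Suc)

lemma esym_le_power:
  assumes "finite S" "\<And>s. s \<in> S \<Longrightarrow> 0 \<le> r s"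
  shows "esym r S i \<le> sum r S ^ i"
proof (induction i)
  case (Suc i)
  have "esym r S (Suc i) \<le> sum r S * esym r S i" using assms by (rule esym_Suc_le)
  also have "\<dots> \<le> sum r S * sum r S ^ i"
    using Suc assms(2) by (intro mult_left_mono sum_nonneg)
  finally show ?case by simp
qed (simp add: esym_0 assms)

text \<open>The inductive step for a given pair \<open>i \<le> j\<close> uses the inequality for the smaller set at pairs with
  other gaps, so ordinary log-concavity \<open>i = j\<close> would not be a strong enough induction hypothesis.\<close>

lemma esym_log_concave:
  assumes "finite S" "\<And>s. s \<in> S \<Longrightarrow> 0 \<le> r s" "i \<le> j"
  shows "esym r S i * esym r S (Suc (Suc j)) \<le> esym r S (Suc i) * esym r S (Suc j)"
  using assms
proof (induction S arbitrary: i j rule: finite_induct)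
  case (insert a S)
  let ?x = "esym r S"
  have nn: "0 \<le> ?x i" "0 \<le> r a" for i
    using insert.prems by (auto intro: esym_nonneg)
  have IH: "?x i * ?x (Suc (Suc j)) \<le> ?x (Suc i) * ?x (Suc j)" if "i \<le> j" for i j
    using insert that by auto
  show ?case
  proof (cases i)
    case 0
    \<comment> \<open>These are the terms left over on the expanded right-hand side once
      \<open>IH\<close> is used and the common term \<open>r a * ?x (Suc j)\<close> cancels.\<close>
    have "0 \<le> r a * (?x 1 * ?x j) + r a * (r a * ?x j)"
      using nn by simp
    then show ?thesis
      using 0 IH[of 0 j] insert.hyps by (simp add: esym_0 esym_insert_Suc algebra_simps)
  next
    case (Suc i')
    then obtain j' where j: "j = Suc j'" "i' \<le> j'" using insert.prems(2) by (cases j) auto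
    \<comment> \<open>Both sides are compared as quadratics in \<open>r a\<close>, coefficient by
      coefficient. In the linear one a common product cancels, and the rest, \<open>r1\<close>,
      chains the inequalities 1 and 2.\<close>
    have 1: "?x i' * ?x (Suc (Suc (Suc j'))) \<le> ?x (Suc i') * ?x (Suc (Suc j'))"
      using IH[of i' "Suc j'"] j by simp
    \<comment> \<open>For \<open>i' = j'\<close> the induction hypothesis does not cover this pair,
      but the two sides are then equal.\<close>
    have 2: "?x (Suc i') * ?x (Suc (Suc j')) \<le> ?x (Suc (Suc i')) * ?x (Suc j')"
      using IH[of "Suc i'" j'] j by (cases "i' = j'") (auto simp: mult.commute)
    have r1: "r a * (?x i' * ?x (Suc (Suc (Suc j')))) \<le> r a * (?x (Suc (Suc i')) * ?x (Suc j'))"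
      using 1 2 nn by (intro mult_left_mono) auto
    have r2: "(r a * r a) * (?x i' * ?x (Suc (Suc j'))) \<le> (r a * r a) * (?x (Suc i') * ?x (Suc j'))"
      using IH[of i' j'] j nn by (intro mult_left_mono) auto
    show ?thesis
      using r1 r2 IH[of "Suc i'" "Suc j'"] j insert.hyps Suc
      by (simp add: esym_insert_Suc algebra_simps)
  qed
qed (simp add: esym_empty_Suc)

section \<open>Passage to the limit of infinitely many trials\<close>

locale trial_probs =
  fixes p :: "nat \<Rightarrow> real"
  assumes p_range: "1 \<le> k \<Longrightarrow> 0 \<le> p k \<and> p k < 1"
    and summable_p: "summable (\<lambda>k. p (Suc k))"
begin

definition no_succ :: "nat \<Rightarrow> real" where
  "no_succ k = (\<Prod>j. 1 - p (k + j))"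

lemma odds_nonneg: "1 \<le> k \<Longrightarrow> 0 \<le> odds p k"
  using p_range[of k] by (simp add: odds_def)

lemma summable_p_from: "1 \<le> k \<Longrightarrow> summable (\<lambda>j. p (k + j))"
  using summable_p summable_ignore_initial_segment[of "\<lambda>j. p (Suc j)" "k - 1"]
  by (simp add: add.commute)

lemma convergent_prod_from:
  assumes "1 \<le> k"
  shows "convergent_prod (\<lambda>j. 1 - p (k + j))"
proof -
  have "summable (\<lambda>j. norm (1 - p (k + j) - 1))"
    using summable_p_from[OF assms] p_range assms by simp
  then show ?thesis
    by (intro abs_convergent_prod_imp_convergent_prod summable_imp_abs_convergent_prod)
qed

lemma no_succ_pos:
  assumes "1 \<le> k"
  shows "0 < no_succ k"
  unfolding no_succ_def
  using convergent_prod_from[OF assms] p_range assms by (intro less_0_prodinf) auto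

lemma no_succ_tendsto:
  assumes "1 \<le> k"
  shows "(\<lambda>n. \<Prod>j\<in>{k..<n}. 1 - p j) \<longlonglongrightarrow> no_succ k"
proof -
  have "(\<lambda>n. \<Prod>j\<le>n. 1 - p (k + j)) \<longlonglongrightarrow> no_succ k"
    unfolding no_succ_def using convergent_prod_from[OF assms] by (rule convergent_prod_LIMSEQ)
  moreover have "(\<Prod>j\<le>n. 1 - p (k + j)) = (\<Prod>j\<in>{k..<n + Suc k}. 1 - p j)" for n
    unfolding prod.atLeastLessThan_shift_0[of _ k "n + Suc k"]
    by (simp add: atLeast0LessThan lessThan_Suc_atMost del: prod.op_ivl_Suc prod.lessThan_Suc)
  ultimately show ?thesis
    using LIMSEQ_offset[of "\<lambda>n. \<Prod>j\<in>{k..<n}. 1 - p j" "Suc k"] by simp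
qed

lemma no_succ_rec:
  assumes "1 \<le> k"
  shows "no_succ k = (1 - p k) * no_succ (Suc k)"
proof (rule LIMSEQ_unique)
  show "(\<lambda>n. \<Prod>j\<in>{k..<n}. 1 - p j) \<longlonglongrightarrow> no_succ k"
    using assms by (rule no_succ_tendsto)
  have "(\<lambda>n. (1 - p k) * (\<Prod>j\<in>{Suc k..<n}. 1 - p j)) \<longlonglongrightarrow> (1 - p k) * no_succ (Suc k)"
    by (intro tendsto_mult tendsto_const no_succ_tendsto) simp
  moreover have "eventually (\<lambda>n. (1 - p k) * (\<Prod>j\<in>{Suc k..<n}. 1 - p j)
      = (\<Prod>j\<in>{k..<n}. 1 - p j)) sequentially"
    using eventually_gt_at_top[of k] by eventually_elim (simp add: prod.atLeast_Suc_lessThan)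
  ultimately show "(\<lambda>n. \<Prod>j\<in>{k..<n}. 1 - p j) \<longlonglongrightarrow> (1 - p k) * no_succ (Suc k)"
    by (rule Lim_transform_eventually)
qed

lemma summable_odds:
  assumes "1 \<le> k"
  shows "summable (\<lambda>j. odds p (k + j))"
proof (rule summable_comparison_test_ev)
  have "(\<lambda>j. p (k + j)) \<longlonglongrightarrow> 0"
    using summable_p_from[OF assms] by (rule summable_LIMSEQ_zero)
  \<comment> \<open>Once \<open>p < 1/2\<close>, the denominator \<open>1 - p\<close> exceeds 1/2
    and the odds are at most \<open>2 * p\<close>.\<close>
  then have "eventually (\<lambda>j. p (k + j) < 1/2) sequentially"
    by (rule order_tendstoD) simp
  then show "eventually (\<lambda>j. norm (odds p (k + j)) \<le> 2 * p (k + j)) sequentially"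
  proof eventually_elim
    case (elim j)
    have "0 \<le> p (k + j)" using p_range assms by simp
    then have "p (k + j) * 1 \<le> p (k + j) * (2 * (1 - p (k + j)))"
      using elim by (intro mult_left_mono) auto
    then have "odds p (k + j) \<le> 2 * p (k + j)"
      using elim by (simp add: odds_def field_simps)
    then show ?case using odds_nonneg[of "k + j"] assms by simp
  qed
  show "summable (\<lambda>j. 2 * p (k + j))"
    using summable_p_from[OF assms] by (rule summable_mult)
qed

lemma sum_odds_le:
  assumes "1 \<le> k"
  shows "sum (odds p) {k..<n} \<le> (\<Sum>j. odds p (k + j))"
proof -
  have "sum (odds p) {k..<n} = (\<Sum>j<n - k. odds p (k + j))"
    unfolding sum.atLeastLessThan_shift_0[of _ k n] by (simp add: atLeast0LessThan)
  also have "\<dots> \<le> (\<Sum>j. odds p (k + j))"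
    using summable_odds[OF assms] odds_nonneg assms by (intro sum_le_suminf) auto
  finally show ?thesis .
qed

text \<open>An unordered sum is a limit along the finite subfamilies of its index set. The families
  \<open>?B n\<close> are finite and eventually contain any given finite subfamily, so the limit may
  be taken along \<open>n\<close>. Summability follows from the uniform bound on finite partial sums
  given by \<open>esym_le_power\<close>.\<close>

lemma esym_tendsto:
  assumes k: "1 \<le> k"
  shows "(\<lambda>n. esym (odds p) {k..<n} i) \<longlonglongrightarrow> elem_sym p i k"
proof -
  let ?A = "{T. T \<subseteq> {k..} \<and> finite T \<and> card T = i}"
  let ?B = "\<lambda>n. {T. T \<subseteq> {k..<n} \<and> card T = i}"
  let ?f = "\<lambda>T. \<Prod>t\<in>T. odds p t"
  have nn: "0 \<le> ?f T" if "T \<in> ?A" for T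
    using that k odds_nonneg by (intro prod_nonneg) auto
  have finB: "finite (?B n)" for n
    by (rule finite_subset[of _ "Pow {k..<n}"]) auto
  have BA: "?B n \<subseteq> ?A" for n
    by (auto dest: finite_subset[of _ "{k..<n}"])
  have sub: "eventually (\<lambda>n. F \<subseteq> ?B n) sequentially" if F: "finite F" "F \<subseteq> ?A" for F
  proof -
    have "finite (\<Union>F)" using F by auto
    then obtain N where N: "\<Union>F \<subseteq> {..<N}" using finite_nat_bounded by blast
    have "F \<subseteq> ?B n" if "N \<le> n" for n
    proof
      fix T assume T: "T \<in> F"
      have "t \<in> {k..<n}" if "t \<in> T" for t
        using T that F N \<open>N \<le> n\<close> by fastforce
      then show "T \<in> ?B n" using T F by auto
    qed
    then show ?thesis unfolding eventually_sequentially by blast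
  qed
  have "sum ?f F \<le> (\<Sum>j. odds p (k + j)) ^ i" if F: "finite F" "F \<subseteq> ?A" for F
  proof -
    obtain n where n: "F \<subseteq> ?B n" using sub[OF F] by (auto dest: eventually_happens)
    have "sum ?f F \<le> sum ?f (?B n)"
      using n finB nn BA[of n] by (intro sum_mono2) blast+
    also have "\<dots> \<le> sum (odds p) {k..<n} ^ i"
      using esym_le_power[of "{k..<n}" "odds p" i] odds_nonneg k by (simp add: esym_def)
    also have "\<dots> \<le> (\<Sum>j. odds p (k + j)) ^ i"
      using sum_odds_le[OF k] odds_nonneg k by (intro power_mono sum_nonneg) auto
    finally show ?thesis .
  qed
  then have "?f summable_on ?A"
    using nn by (intro nonneg_bdd_above_summable_on) (auto simp: bdd_above_def)
  then have "(sum ?f \<longlongrightarrow> elem_sym p i k) (finite_subsets_at_top ?A)"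
    unfolding elem_sym_def by (simp add: has_sum_def[symmetric])
  moreover have "filterlim ?B (finite_subsets_at_top ?A) sequentially"
    unfolding filterlim_finite_subsets_at_top
  proof (intro allI impI)
    fix F assume F: "finite F \<and> F \<subseteq> ?A"
    then have "eventually (\<lambda>n. F \<subseteq> ?B n) sequentially" using sub by blast
    then show "eventually (\<lambda>n. finite (?B n) \<and> F \<subseteq> ?B n \<and> ?B n \<subseteq> ?A) sequentially"
    proof eventually_elim
      case (elim n)
      then show ?case using finB[of n] BA[of n] by blast
    qed
  qed
  ultimately show ?thesis
    unfolding esym_def by (rule filterlim_compose)
qed

lemma elem_sym_nonneg: "1 \<le> k \<Longrightarrow> 0 \<le> elem_sym p i k"
  by (rule LIMSEQ_le_const[OF esym_tendsto]) (auto intro!: esym_nonneg odds_nonneg)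

lemma elem_sym_0: "1 \<le> k \<Longrightarrow> elem_sym p 0 k = 1"
  using LIMSEQ_unique[OF esym_tendsto[of k 0]] by (simp add: esym_0)

lemma elem_sym_Suc:
  assumes "1 \<le> k"
  shows "elem_sym p (Suc i) k = elem_sym p (Suc i) (Suc k) + odds p k * elem_sym p i (Suc k)"
proof (rule LIMSEQ_unique)
  show "(\<lambda>n. esym (odds p) {k..<n} (Suc i)) \<longlonglongrightarrow> elem_sym p (Suc i) k"
    using assms by (rule esym_tendsto)
  let ?g = "\<lambda>n. esym (odds p) {Suc k..<n} (Suc i) + odds p k * esym (odds p) {Suc k..<n} i"
  let ?L = "elem_sym p (Suc i) (Suc k) + odds p k * elem_sym p i (Suc k)"
  have "?g \<longlonglongrightarrow> ?L"
    by (intro tendsto_intros esym_tendsto) auto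
  moreover have "eventually (\<lambda>n. ?g n = esym (odds p) {k..<n} (Suc i)) sequentially"
    using eventually_gt_at_top[of k]
  proof eventually_elim
    case (elim n)
    then have "{k..<n} = insert k {Suc k..<n}" by auto
    then show ?case by (simp add: esym_insert_Suc)
  qed
  ultimately show "(\<lambda>n. esym (odds p) {k..<n} (Suc i)) \<longlonglongrightarrow> ?L"
    by (rule Lim_transform_eventually)
qed

lemma elem_sym_log_concave:
  assumes "1 \<le> k" "i \<le> j"
  shows "elem_sym p i k * elem_sym p (Suc (Suc j)) k \<le> elem_sym p (Suc i) k * elem_sym p (Suc j) k"
proof (rule LIMSEQ_le)
  show "(\<lambda>n. esym (odds p) {k..<n} i * esym (odds p) {k..<n} (Suc (Suc j)))
      \<longlonglongrightarrow> elem_sym p i k * elem_sym p (Suc (Suc j)) k"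
    by (intro tendsto_mult esym_tendsto assms)
  show "(\<lambda>n. esym (odds p) {k..<n} (Suc i) * esym (odds p) {k..<n} (Suc j))
      \<longlonglongrightarrow> elem_sym p (Suc i) k * elem_sym p (Suc j) k"
    by (intro tendsto_mult esym_tendsto assms)
qed (use assms odds_nonneg in \<open>auto intro!: esym_log_concave\<close>)

lemma elem_sym_Suc_le:
  assumes "1 \<le> k"
  shows "elem_sym p (Suc i) k \<le> (\<Sum>j. odds p (k + j)) * elem_sym p i k"
proof (rule LIMSEQ_le)
  show "(\<lambda>n. esym (odds p) {k..<n} (Suc i)) \<longlonglongrightarrow> elem_sym p (Suc i) k"
    using assms by (rule esym_tendsto)
  show "(\<lambda>n. (\<Sum>j. odds p (k + j)) * esym (odds p) {k..<n} i)
      \<longlonglongrightarrow> (\<Sum>j. odds p (k + j)) * elem_sym p i k"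
    by (intro tendsto_mult tendsto_const esym_tendsto assms)
  have "esym (odds p) {k..<n} (Suc i) \<le> (\<Sum>j. odds p (k + j)) * esym (odds p) {k..<n} i" for n
  proof -
    have "esym (odds p) {k..<n} (Suc i) \<le> sum (odds p) {k..<n} * esym (odds p) {k..<n} i"
      using odds_nonneg assms by (intro esym_Suc_le) auto
    also have "\<dots> \<le> (\<Sum>j. odds p (k + j)) * esym (odds p) {k..<n} i"
      using odds_nonneg assms by (intro mult_right_mono sum_odds_le esym_nonneg) auto
    finally show ?thesis .
  qed
  then show "\<exists>N. \<forall>n\<ge>N. esym (odds p) {k..<n} (Suc i)
      \<le> (\<Sum>j. odds p (k + j)) * esym (odds p) {k..<n} i" by blast
qed

section \<open>The threshold set is nonempty and upward closed\<close>

text \<open>Far enough out the tail sum of the odds is below 1, so \<open>elem_sym_Suc_le\<close>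
  makes \<open>elem_sym\<close> nonincreasing in its degree; then compare the degrees
  \<open>l - 1\<close> and \<open>m\<close>.\<close>

lemma threshold_set_nonempty:
  assumes "1 \<le> l" "l \<le> m"
  shows "threshold_set p l m \<noteq> {}"
proof -
  have "(\<lambda>n. \<Sum>j. odds p (1 + (j + n))) \<longlonglongrightarrow> 0"
    by (rule suminf_exist_split2[OF summable_odds]) simp
  then have "eventually (\<lambda>n. (\<Sum>j. odds p (1 + (j + n))) < 1) sequentially"
    by (rule order_tendstoD) simp
  then have "eventually (\<lambda>n. (\<Sum>j. odds p (1 + (j + n))) < 1 \<and> 1 \<le> n) sequentially"
    using eventually_ge_at_top[of 1] by eventually_elim simp
  then obtain n where n: "(\<Sum>j. odds p (1 + (j + n))) < 1" "1 \<le> n"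
    by (auto dest: eventually_happens)
  have "(\<lambda>j. odds p (n + 1 + j)) = (\<lambda>j. odds p (1 + (j + n)))"
    by (simp add: ac_simps)
  then have lt: "(\<Sum>j. odds p (n + 1 + j)) < 1" using n by simp
  have "elem_sym p (Suc i) (n + 1) \<le> elem_sym p i (n + 1)" for i
  proof -
    have "elem_sym p (Suc i) (n + 1) \<le> (\<Sum>j. odds p (n + 1 + j)) * elem_sym p i (n + 1)"
      by (rule elem_sym_Suc_le) simp
    also have "\<dots> \<le> 1 * elem_sym p i (n + 1)"
      using lt by (intro mult_right_mono elem_sym_nonneg) auto
    finally show ?thesis by simp
  qed
  then have "elem_sym p m (n + 1) \<le> elem_sym p (l - 1) (n + 1)"
    by (rule lift_Suc_antimono_le[of "\<lambda>i. elem_sym p i (n + 1)"]) (use assms in auto)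
  then show ?thesis using n by (auto simp: threshold_set_def)
qed

text \<open>Log-concavity makes the ratio \<open>e\<^sub>m(k) / e\<^sub>l\<^sub>-\<^sub>1(k)\<close> nonincreasing in \<open>k\<close>.\<close>

lemma threshold_set_Suc:
  assumes l: "1 \<le> l" "l \<le> m" and j: "j \<in> threshold_set p l m"
  shows "Suc j \<in> threshold_set p l m"
proof (rule ccontr)
  let ?k = "Suc (Suc j)"
  assume "Suc j \<notin> threshold_set p l m"
  then have gt: "elem_sym p (l - 1) ?k < elem_sym p m ?k"
    by (simp add: threshold_set_def)
  obtain m' where m: "m = Suc m'" using l by (cases m) auto
  have j1: "1 \<le> j" and le: "elem_sym p m (Suc j) \<le> elem_sym p (l - 1) (Suc j)"
    using j by (auto simp: threshold_set_def)
  have r: "0 \<le> odds p (Suc j)" by (intro odds_nonneg) simp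
  show False
  proof (cases "l - 1")
    case 0
    \<comment> \<open>For \<open>l = 1\<close> the right-hand side of the threshold inequality is
      the constant 1, while the left-hand side can only fall as \<open>k\<close> grows.\<close>
    have "elem_sym p m ?k \<le> elem_sym p m (Suc j)"
      using r elem_sym_nonneg[of ?k m'] unfolding m by (subst (2) elem_sym_Suc) auto
    then show False using le gt 0 by (simp add: elem_sym_0)
  next
    case (Suc l')
    then obtain m'' where m'': "m' = Suc m''" "l' \<le> m''" using l m by (cases m') auto
    \<comment> \<open>With \<open>l' = l - 2\<close> and \<open>m' = m - 1\<close>, log-concavity
      carries the assumed strict inequality between degrees \<open>l - 1\<close> and
      \<open>m\<close> down to a weak one between \<open>l'\<close> and \<open>m'\<close>. Adding
      trial \<open>Suc j\<close> to both then contradicts \<open>le\<close>.\<close>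
    have lc: "elem_sym p l' ?k * elem_sym p m ?k \<le> elem_sym p (l - 1) ?k * elem_sym p m' ?k"
      using elem_sym_log_concave[of ?k l' m''] m'' Suc m by simp
    have pos: "0 < elem_sym p m ?k"
      using gt elem_sym_nonneg[of ?k "l - 1"] by simp
    have "elem_sym p (l - 1) ?k * elem_sym p m' ?k \<le> elem_sym p m ?k * elem_sym p m' ?k"
      using gt by (intro mult_right_mono elem_sym_nonneg) auto
    then have "elem_sym p l' ?k * elem_sym p m ?k \<le> elem_sym p m' ?k * elem_sym p m ?k"
      using lc by (simp add: mult.commute)
    then have "elem_sym p l' ?k \<le> elem_sym p m' ?k"
      using pos by simp
    then have "odds p (Suc j) * elem_sym p l' ?k \<le> odds p (Suc j) * elem_sym p m' ?k"
      using r by (rule mult_left_mono)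
    then show False
      using le gt elem_sym_Suc[of "Suc j" m'] elem_sym_Suc[of "Suc j" l'] m Suc by simp
  qed
qed

lemma threshold_set_mono:
  assumes "1 \<le> l" "l \<le> m" "j \<in> threshold_set p l m" "j \<le> k"
  shows "k \<in> threshold_set p l m"
  using assms(4,3) by (induction rule: dec_induct) (auto intro: threshold_set_Suc assms)

section \<open>One-step recursions and the value of the threshold rule\<close>

lemma succ_prob_eq: "succ_prob p i k = no_succ k * elem_sym p i k"
  by (simp add: succ_prob_def no_succ_def)

lemma succ_prob_nonneg: "1 \<le> k \<Longrightarrow> 0 \<le> succ_prob p i k"
  using no_succ_pos[of k] elem_sym_nonneg[of k i] by (simp add: succ_prob_eq)

text \<open>Total probability over the outcome of trial \<open>k\<close>, obtained algebraically
  from \<open>(1 - p k) * odds p k = p k\<close>.\<close>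

lemma succ_prob_Suc:
  assumes "1 \<le> k"
  shows "succ_prob p (Suc i) k
    = (1 - p k) * succ_prob p (Suc i) (Suc k) + p k * succ_prob p i (Suc k)"
proof -
  let ?s = "no_succ (Suc k)"
  have "succ_prob p (Suc i) k = (1 - p k) * (?s * elem_sym p (Suc i) (Suc k))
      + ((1 - p k) * odds p k) * (?s * elem_sym p i (Suc k))"
    unfolding succ_prob_eq no_succ_rec[OF assms] elem_sym_Suc[OF assms] by (simp add: algebra_simps)
  also have "(1 - p k) * odds p k = p k" using p_range[OF assms] by (simp add: odds_def)
  finally show ?thesis by (simp add: succ_prob_eq)
qed

text \<open>The probability of winning by stopping on a success at time \<open>k\<close>.\<close>

definition stop_val :: "nat \<Rightarrow> nat \<Rightarrow> nat \<Rightarrow> real" where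
  "stop_val l m k = (\<Sum>i=l..m. succ_prob p (i - 1) (Suc k))"

text \<open>The first success from \<open>k\<close> on is either \<open>k\<close> itself or the
  first one from \<open>Suc k\<close> on. Since \<open>l\<close> is positive, the index
  \<open>i - 1\<close> is never truncated.\<close>

lemma u_val_rec:
  assumes "1 \<le> l" "1 \<le> k"
  shows "u_val p m k l = (1 - p k) * u_val p m (Suc k) l + p k * stop_val l m k"
proof -
  have "succ_prob p i k = (1 - p k) * succ_prob p i (Suc k) + p k * succ_prob p (i - 1) (Suc k)"
    if "i \<in> {l..m}" for i
    using that assms succ_prob_Suc[of k "i - 1"] by simp
  then show ?thesis
    unfolding u_val_def stop_val_def sum_distrib_left
    by (simp flip: sum.distrib)
qed

text \<open>The windows \<open>l - 1..m - 1\<close> and \<open>l..m\<close> share everything but one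
  end point each, so the difference telescopes.\<close>

lemma stop_val_diff:
  assumes "1 \<le> l" "l \<le> m"
  shows "stop_val l m k - u_val p m (Suc k) l = succ_prob p (l - 1) (Suc k) - succ_prob p m (Suc k)"
proof -
  have "stop_val l m k - u_val p m (Suc k) l
      = - (\<Sum>i=l..m. succ_prob p i (Suc k) - succ_prob p (i - 1) (Suc k))"
    unfolding stop_val_def u_val_def by (simp add: sum_subtractf)
  also have "\<dots> = succ_prob p (l - 1) (Suc k) - succ_prob p m (Suc k)"
    using sum_telescope''[of "l - 1" m "\<lambda>i. succ_prob p i (Suc k)"] assms by simp
  finally show ?thesis .
qed

text \<open>The common factor \<open>no_succ (Suc k)\<close> is positive and cancels. This turns the
  algebraic threshold into a comparison of stopping now with waiting for the next success.\<close>

lemma threshold_set_iff: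
  assumes "1 \<le> l" "l \<le> m" "1 \<le> k"
  shows "k \<in> threshold_set p l m \<longleftrightarrow> u_val p m (Suc k) l \<le> stop_val l m k"
proof -
  have "u_val p m (Suc k) l \<le> stop_val l m k
      \<longleftrightarrow> succ_prob p m (Suc k) \<le> succ_prob p (l - 1) (Suc k)"
    using stop_val_diff[of l m k] assms by linarith
  then show ?thesis
    using assms no_succ_pos[of "Suc k"] by (simp add: threshold_set_def succ_prob_eq)
qed

lemma opt_index_in: "1 \<le> l \<Longrightarrow> l \<le> m \<Longrightarrow> opt_index p l m \<in> threshold_set p l m"
  unfolding opt_index_def using threshold_set_nonempty[of l m] by (auto intro: LeastI)

lemma opt_index_ge: "1 \<le> l \<Longrightarrow> l \<le> m \<Longrightarrow> 1 \<le> opt_index p l m"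
  using opt_index_in[of l m] by (simp add: threshold_set_def)

definition opt_val :: "nat \<Rightarrow> nat \<Rightarrow> nat \<Rightarrow> real" where
  "opt_val l m k = u_val p m (max k (opt_index p l m)) l"

lemma opt_val_nonneg: "1 \<le> k \<Longrightarrow> 0 \<le> opt_val l m k"
  unfolding opt_val_def u_val_def by (intro sum_nonneg succ_prob_nonneg) simp

text \<open>Below the threshold index a success is worth less than waiting, so by
  \<open>u_val_rec\<close> starting one trial later does not lower the value. Induct downward from
  the threshold index.\<close>

lemma u_val_le_opt:
  assumes "1 \<le> l" "l \<le> m" "1 \<le> k" "k \<le> opt_index p l m"
  shows "u_val p m k l \<le> u_val p m (opt_index p l m) l"
  using assms(4,3)
proof (induction rule: inc_induct)
  case (step k)
  have "k \<notin> threshold_set p l m"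
    using not_less_Least step.hyps unfolding opt_index_def by blast
  then have "stop_val l m k < u_val p m (Suc k) l"
    using threshold_set_iff assms step.prems by simp
  then have "p k * stop_val l m k \<le> p k * u_val p m (Suc k) l"
    using p_range[of k] step.prems by (intro mult_left_mono) auto
  then have "u_val p m k l \<le> u_val p m (Suc k) l"
    using u_val_rec[of l k m] assms step.prems by (simp add: algebra_simps)
  then show ?case using step by simp
qed simp

text \<open>Here \<open>P\<close> is the probability of not having stopped before time \<open>k\<close> and \<open>q\<close> that of stopping at
  time \<open>k\<close>.\<close>

lemma opt_val_step:
  assumes lm: "1 \<le> l" "l \<le> m" and k: "1 \<le> k" and q: "0 \<le> q" "q \<le> P * p k"
  shows "q * stop_val l m k + (P - q) * opt_val l m (Suc k) \<le> P * opt_val l m k"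
proof (cases "opt_index p l m \<le> k")
  case True
  then have "k \<in> threshold_set p l m"
    using threshold_set_mono lm opt_index_in by blast
  \<comment> \<open>By the recursion for \<open>u_val\<close>, this product is exactly the
    difference of the two sides of the claim.\<close>
  then have le: "0 \<le> (P * p k - q) * (stop_val l m k - u_val p m (Suc k) l)"
    using q threshold_set_iff lm k by simp
  have now: "opt_val l m k = (1 - p k) * u_val p m (Suc k) l + p k * stop_val l m k"
    using True u_val_rec[of l k m] lm k by (simp add: opt_val_def max_absorb1)
  have later: "opt_val l m (Suc k) = u_val p m (Suc k) l"
    using True by (simp add: opt_val_def max_absorb1)
  show ?thesis unfolding now later using le by (simp add: algebra_simps)
next
  case False
  have "k \<notin> threshold_set p l m"
    using False not_less_Least unfolding opt_index_def by (metis not_le)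
  then have "stop_val l m k < u_val p m (Suc k) l"
    using threshold_set_iff lm k by simp
  \<comment> \<open>Before the threshold index \<open>opt_val\<close> is constant in
    \<open>k\<close> and at least the value of waiting, so any mass \<open>q\<close> that stops now
    only loses.\<close>
  also have "\<dots> \<le> opt_val l m k"
    using u_val_le_opt[of l m "Suc k"] lm False by (simp add: opt_val_def max_absorb2)
  finally have "q * stop_val l m k \<le> q * opt_val l m k"
    using q by (intro mult_left_mono) auto
  moreover have "opt_val l m (Suc k) = opt_val l m k"
    using False by (simp add: opt_val_def max_absorb2)
  ultimately show ?thesis by (simp add: algebra_simps)
qed

end

section \<open>Success sets and the first success\<close>

definition succs :: "(nat \<Rightarrow> 'a \<Rightarrow> bool) \<Rightarrow> nat \<Rightarrow> 'a \<Rightarrow> nat set" where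
  "succs X k \<omega> = {j. k \<le> j \<and> X j \<omega>}"

lemma succs_eq_iff: "T \<subseteq> {k..} \<Longrightarrow> succs X k \<omega> = T \<longleftrightarrow> (\<forall>j\<ge>k. X j \<omega> \<longleftrightarrow> j \<in> T)"
  by (auto simp: succs_def)

lemma succs_success: "X n \<omega> \<Longrightarrow> succs X n \<omega> = insert n (succs X (Suc n) \<omega>)"
  by (auto simp: succs_def)

text \<open>In \<open>enat\<close> the infimum of the empty set is the top element, so absence of
  successes means never stopping; a nonempty set attains its infimum.\<close>

lemma first_success_from_eq:
  "first_success_from X k \<omega>
    = (if succs X k \<omega> = {} then \<infinity> else enat (LEAST j. j \<in> succs X k \<omega>))"
proof (cases "succs X k \<omega> = {}")
  case True
  then have "{j. k \<le> j \<and> X j \<omega>} = {}" by (simp add: succs_def)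
  then show ?thesis
    using True unfolding first_success_from_def by (simp only: image_empty Inf_empty top_enat_def refl if_True)
next
  case False
  let ?n = "LEAST j. j \<in> succs X k \<omega>"
  have "?n \<in> succs X k \<omega>" using False by (auto intro: LeastI)
  then have "(INF j\<in>succs X k \<omega>. enat j) = enat ?n"
    by (intro antisym INF_lower INF_greatest) (auto intro: Least_le)
  then show ?thesis using False by (simp add: first_success_from_def succs_def)
qed

text \<open>By minimality no success lies in \<open>{k..<n}\<close>. Hence the count from the random
  time \<open>n\<close> can be read off from the fixed time \<open>k\<close>.\<close>

lemma first_success_from_enatD:
  assumes "first_success_from X k \<omega> = enat n"
  shows "k \<le> n" "X n \<omega>" "succs X n \<omega> = succs X k \<omega>"
proof -
  have ne: "succs X k \<omega> \<noteq> {}" and n: "n = (LEAST j. j \<in> succs X k \<omega>)"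
    using assms by (auto simp: first_success_from_eq split: if_splits)
  have n_in: "n \<in> succs X k \<omega>" unfolding n using ne by (auto intro: LeastI)
  then show "k \<le> n" "X n \<omega>" by (auto simp: succs_def)
  have "n \<le> j" if "j \<in> succs X k \<omega>" for j unfolding n using that by (rule Least_le)
  then show "succs X n \<omega> = succs X k \<omega>" using n_in by (auto simp: succs_def)
qed

lemma first_success_from_le_iff:
  "first_success_from X k \<omega> \<le> enat n \<longleftrightarrow> (\<exists>j\<in>{k..n}. X j \<omega>)"
proof
  assume "first_success_from X k \<omega> \<le> enat n"
  then obtain i where "first_success_from X k \<omega> = enat i" "i \<le> n"
    by (cases "first_success_from X k \<omega>") auto
  then show "\<exists>j\<in>{k..n}. X j \<omega>" using first_success_from_enatD[of X k \<omega> i] by auto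
next
  assume "\<exists>j\<in>{k..n}. X j \<omega>"
  then obtain j where j: "j \<in> {k..n}" "X j \<omega>" by blast
  then have "first_success_from X k \<omega> \<le> enat j"
    unfolding first_success_from_def by (intro INF_lower) auto
  also have "\<dots> \<le> enat n" using j by simp
  finally show "first_success_from X k \<omega> \<le> enat n" .
qed

\<comment> \<open>The simproc diverges on hypotheses of the form \<open>{\<omega>\<in>space M. P \<omega>} \<in> sets N\<close>.\<close>
declare [[simproc del: measurable]]

section \<open>Independence of past and future trials\<close>

locale bernoulli_trials = prob_space M + trial_probs p
  for M :: "'a measure" and X :: "nat \<Rightarrow> 'a \<Rightarrow> bool" and p :: "nat \<Rightarrow> real" +
  assumes indep: "indep_vars (\<lambda>_. count_space UNIV) X {1..}"
    and prob_X: "1 \<le> k \<Longrightarrow> prob {\<omega>\<in>space M. X k \<omega>} = p k"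
begin

text \<open>The sigma-algebra generated by the trials in \<open>I\<close>, with preimages as
  generators to match the form that \<open>indep_sets_collect_sigma\<close> gives for blocks of
  independent variables.\<close>

definition info :: "nat set \<Rightarrow> 'a measure" where
  "info I = sigma (space M) (\<Union>i\<in>I. {X i -` A \<inter> space M | A. A \<in> sets (count_space UNIV)})"

lemma sets_info:
  "sets (info I) = sigma_sets (space M)
    (\<Union>i\<in>I. {X i -` A \<inter> space M | A. A \<in> sets (count_space UNIV)})"
  unfolding info_def by (rule sets_measure_of) auto

lemma space_info: "space (info I) = space M"
  unfolding info_def by (rule space_measure_of) auto

lemma pred_info:
  assumes "i \<in> I"
  shows "Measurable.pred (info I) (X i)"
proof -
  have "{\<omega>\<in>space M. X i \<omega>} = X i -` {True} \<inter> space M" by auto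
  then have "{\<omega>\<in>space M. X i \<omega>} \<in> sets (info I)"
    using assms unfolding sets_info by (auto intro!: sigma_sets.Basic)
  then show ?thesis by (simp add: pred_def space_info)
qed

text \<open>Disjoint blocks of independent variables generate independent sigma-algebras; here the
  blocks are the trials up to \<open>n\<close> and those after \<open>n\<close>, indexed by the two
  truth values.\<close>

lemma indep_info:
  assumes A: "A \<in> sets (info {1..n})" and B: "B \<in> sets (info {Suc n..})"
  shows "A \<in> events" "B \<in> events" "prob (A \<inter> B) = prob A * prob B"
proof -
  let ?E = "\<lambda>i. {X i -` A \<inter> space M | A. A \<in> sets (count_space UNIV)}"
  let ?I = "case_bool {1..n} {Suc n..}"
  have "indep_sets ?E {1..}" using indep by (simp add: indep_vars_def2)
  moreover have "(\<Union>j\<in>UNIV. ?I j) = {1..}" by (auto simp: UNIV_bool)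
  ultimately have "indep_sets (\<lambda>j. sigma_sets (space M) (\<Union>i\<in>?I j. ?E i)) UNIV"
  proof (intro indep_sets_collect_sigma)
    show "disjoint_family_on ?I UNIV"
      by (auto simp: disjoint_family_on_def split: bool.split)
    show "Int_stable (?E i)" for i
    proof (rule Int_stableI)
      fix a b assume "a \<in> ?E i" "b \<in> ?E i"
      then obtain a' b' where "a = X i -` a' \<inter> space M" "b = X i -` b' \<inter> space M" by auto
      then have "a \<inter> b = X i -` (a' \<inter> b') \<inter> space M" by blast
      then show "a \<inter> b \<in> ?E i" by (intro CollectI exI[of _ "a' \<inter> b'"]) simp
    qed
  qed simp
  moreover have "(\<lambda>j. sigma_sets (space M) (\<Union>i\<in>?I j. ?E i))
      = case_bool (sets (info {1..n})) (sets (info {Suc n..}))"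
    by (auto simp: fun_eq_iff sets_info split: bool.split)
  ultimately have ind: "indep_set (sets (info {1..n})) (sets (info {Suc n..}))"
    unfolding indep_set_def by simp
  show "A \<in> events" "B \<in> events" "prob (A \<inter> B) = prob A * prob B"
    using indep_setD_ev1[OF ind] indep_setD_ev2[OF ind] indep_setD[OF ind] A B by auto
qed

lemma succs_eq_info:
  assumes "T \<subseteq> {k..}"
  shows "{\<omega>\<in>space M. succs X k \<omega> = T} \<in> sets (info {k..})"
proof -
  have "Measurable.pred (info {k..}) (\<lambda>\<omega>. \<forall>j. k \<le> j \<longrightarrow> (X j \<omega> \<longleftrightarrow> j \<in> T))"
  proof (intro pred_intros_countable pred_intros_imp')
    fix j assume "k \<le> j"
    then have "Measurable.pred (info {k..}) (X j)" by (intro pred_info) simp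
    then show "Measurable.pred (info {k..}) (\<lambda>\<omega>. X j \<omega> \<longleftrightarrow> j \<in> T)"
      by (cases "j \<in> T") (simp_all add: pred_intros_logic)
  qed
  then show ?thesis using assms by (simp add: pred_def space_info succs_eq_iff)
qed

text \<open>There are only countably many finite sets of trials, so the event is a countable union
  of events fixing \<open>succs X k \<omega>\<close>.\<close>

lemma count_info:
  "{\<omega>\<in>space M. finite (succs X k \<omega>) \<and> card (succs X k \<omega>) \<in> I} \<in> sets (info {k..})"
proof -
  let ?T = "{T. finite T \<and> T \<subseteq> {k..} \<and> card T \<in> I}"
  have "countable ?T"
    by (rule countable_subset[OF _ countable_Collect_finite]) auto
  then have "(\<Union>T\<in>?T. {\<omega>\<in>space M. succs X k \<omega> = T}) \<in> sets (info {k..})"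
    by (rule sets.countable_UN') (auto intro!: succs_eq_info)
  moreover have "{\<omega>\<in>space M. finite (succs X k \<omega>) \<and> card (succs X k \<omega>) \<in> I}
      = (\<Union>T\<in>?T. {\<omega>\<in>space M. succs X k \<omega> = T})"
    by (auto simp: succs_def)
  ultimately show ?thesis by simp
qed

lemma info_events:
  assumes "1 \<le> k" "A \<in> sets (info {k..})"
  shows "A \<in> events"
  \<comment> \<open>The future block after \<open>k - 1\<close> is \<open>{k..}\<close> because
    \<open>k\<close> is positive; the empty set serves as the event of the past.\<close>
  using indep_info(2)[of "{}" "k - 1" A] assms by simp

lemma X_event: "1 \<le> k \<Longrightarrow> {\<omega>\<in>space M. X k \<omega>} \<in> events"
  using info_events[of k] pred_info[of k "{k..}"] by (simp add: pred_def space_info)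

section \<open>Distribution of the number of successes\<close>

lemma prob_finite_pattern:
  assumes k: "1 \<le> k"
  shows "{\<omega>\<in>space M. \<forall>j\<in>{k..<n}. X j \<omega> \<longleftrightarrow> j \<in> T} \<in> events" (is "?A \<in> _")
    and "prob {\<omega>\<in>space M. \<forall>j\<in>{k..<n}. X j \<omega> \<longleftrightarrow> j \<in> T}
      = (\<Prod>j\<in>{k..<n}. if j \<in> T then p j else 1 - p j)"
proof -
  have "Measurable.pred M (X j)" if "j \<in> {k..<n}" for j
    using X_event[of j] that k by (simp add: pred_def)
  then have "Measurable.pred M (\<lambda>\<omega>. X j \<omega> \<longleftrightarrow> j \<in> T)" if "j \<in> {k..<n}" for j
    using that by (cases "j \<in> T") (simp_all add: pred_intros_logic)
  then have "Measurable.pred M (\<lambda>\<omega>. \<forall>j\<in>{k..<n}. X j \<omega> \<longleftrightarrow> j \<in> T)"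
    by (intro pred_intros_finite) auto
  then show "?A \<in> events" by (simp add: pred_def)
  show "prob ?A = (\<Prod>j\<in>{k..<n}. if j \<in> T then p j else 1 - p j)"
  proof (cases "{k..<n} = {}")
    \<comment> \<open>An empty window imposes no condition. It is treated apart because an empty
      intersection would not be \<open>space M\<close>.\<close>
    case True
    then show ?thesis by (simp add: prob_space)
  next
    case False
    \<comment> \<open>The singleton of the truth value \<open>j \<in> T\<close> covers prescribed
      successes and prescribed failures in one formula.\<close>
    have pj: "prob (X j -` {j \<in> T} \<inter> space M) = (if j \<in> T then p j else 1 - p j)"
      if "j \<in> {k..<n}" for j
    proof (cases "j \<in> T")
      case True
      then have "X j -` {j \<in> T} \<inter> space M = {\<omega>\<in>space M. X j \<omega>}" by auto
      then show ?thesis using True prob_X that k by simp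
    next
      case False
      then have "X j -` {j \<in> T} \<inter> space M = space M - {\<omega>\<in>space M. X j \<omega>}" by auto
      then show ?thesis using False prob_X X_event that k by (simp add: prob_compl)
    qed
    have "?A = (\<Inter>j\<in>{k..<n}. X j -` {j \<in> T} \<inter> space M)" using False by auto
    also have "prob \<dots> = (\<Prod>j\<in>{k..<n}. prob (X j -` {j \<in> T} \<inter> space M))"
      using k False by (intro indep_varsD[OF indep]) auto
    also have "\<dots> = (\<Prod>j\<in>{k..<n}. if j \<in> T then p j else 1 - p j)"
      using pj by (intro prod.cong) auto
    finally show ?thesis .
  qed
qed

text \<open>Writing \<open>p j\<close> as \<open>(1 - p j) * odds p j\<close> for \<open>j\<close>
  in \<open>T\<close> separates the probability of a finite pattern into a no-success product and
  the odds of \<open>T\<close>. The patterns decrease to the event as the window grows.\<close>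

lemma prob_succs_eq:
  assumes k: "1 \<le> k" and T: "finite T" "T \<subseteq> {k..}"
  shows "prob {\<omega>\<in>space M. succs X k \<omega> = T} = no_succ k * (\<Prod>t\<in>T. odds p t)"
proof -
  let ?A = "\<lambda>n. {\<omega>\<in>space M. \<forall>j\<in>{k..<n}. X j \<omega> \<longleftrightarrow> j \<in> T}"
  obtain N where N: "T \<subseteq> {..<N}" using T finite_nat_bounded by blast
  have pA: "prob (?A n) = (\<Prod>j\<in>{k..<n}. 1 - p j) * (\<Prod>t\<in>T. odds p t)" if "N \<le> n" for n
  proof -
    have "prob (?A n) = (\<Prod>j\<in>{k..<n}. (1 - p j) * (if j \<in> T then odds p j else 1))"
      unfolding prob_finite_pattern[OF k]
    proof (intro prod.cong refl)
      fix j assume "j \<in> {k..<n}"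
      then have "p j < 1" using p_range[of j] k by simp
      then show "(if j \<in> T then p j else 1 - p j) = (1 - p j) * (if j \<in> T then odds p j else 1)"
        by (simp add: odds_def)
    qed
    also have "\<dots> = (\<Prod>j\<in>{k..<n}. 1 - p j) * (\<Prod>j\<in>{k..<n}. if j \<in> T then odds p j else 1)"
      by (rule prod.distrib)
    also have "(\<Prod>j\<in>{k..<n}. if j \<in> T then odds p j else 1) = (\<Prod>j\<in>{k..<n} \<inter> T. odds p j)"
      by (simp add: prod.inter_restrict)
    also have "{k..<n} \<inter> T = T" using T N that by fastforce
    finally show ?thesis .
  qed
  have "(\<lambda>n. prob (?A n)) \<longlonglongrightarrow> prob (\<Inter>n. ?A n)"
    using prob_finite_pattern(1)[OF k] by (intro finite_Lim_measure_decseq) (auto simp: decseq_def)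
  also have "(\<Inter>n. ?A n) = {\<omega>\<in>space M. succs X k \<omega> = T}"
  proof -
    have "(\<forall>n. \<forall>j\<in>{k..<n}. Q j) \<longleftrightarrow> (\<forall>j\<ge>k. Q j)" for Q :: "nat \<Rightarrow> bool"
      by (meson atLeastLessThan_iff lessI)
    then show ?thesis unfolding succs_eq_iff[OF T(2)] by (intro set_eqI) simp
  qed
  finally have "(\<lambda>n. prob (?A n)) \<longlonglongrightarrow> prob {\<omega>\<in>space M. succs X k \<omega> = T}" .
  moreover have "(\<lambda>n. (\<Prod>j\<in>{k..<n}. 1 - p j) * (\<Prod>t\<in>T. odds p t))
      \<longlonglongrightarrow> no_succ k * (\<Prod>t\<in>T. odds p t)"
    by (intro tendsto_mult no_succ_tendsto tendsto_const k)
  then have "(\<lambda>n. prob (?A n)) \<longlonglongrightarrow> no_succ k * (\<Prod>t\<in>T. odds p t)"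
    by (rule Lim_transform_eventually) (rule eventually_sequentiallyI[of N], simp only: pA)
  ultimately show ?thesis by (rule LIMSEQ_unique)
qed

text \<open>Exhaust the event by the increasing events that all successes occur before
  \<open>n\<close>. Each is a finite disjoint union over success sets, which yields
  \<open>esym\<close> on the window.\<close>

lemma prob_count_eq:
  assumes k: "1 \<le> k"
  shows "prob {\<omega>\<in>space M. finite (succs X k \<omega>) \<and> card (succs X k \<omega>) = i} = succ_prob p i k"
proof -
  let ?B = "\<lambda>n. {\<omega>\<in>space M. succs X k \<omega> \<subseteq> {k..<n} \<and> card (succs X k \<omega>) = i}"
  let ?T = "\<lambda>n. {T. T \<subseteq> {k..<n} \<and> card T = i}"
  have B: "?B n = (\<Union>T\<in>?T n. {\<omega>\<in>space M. succs X k \<omega> = T})" for n by auto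
  have fin: "finite (?T n)" for n by (rule finite_subset[of _ "Pow {k..<n}"]) auto
  have ev: "{\<omega>\<in>space M. succs X k \<omega> = T} \<in> events" if "T \<in> ?T n" for n T
    using that k by (intro info_events[of k] succs_eq_info) auto
  have Bev: "?B n \<in> events" for n
    unfolding B using ev fin by (intro sets.finite_UN) auto
  have "prob (?B n) = no_succ k * esym (odds p) {k..<n} i" for n
  proof -
    have "prob (?B n) = (\<Sum>T\<in>?T n. prob {\<omega>\<in>space M. succs X k \<omega> = T})"
      unfolding B using fin ev
      by (intro finite_measure_finite_Union) (auto simp: disjoint_family_on_def)
    also have "\<dots> = (\<Sum>T\<in>?T n. no_succ k * (\<Prod>t\<in>T. odds p t))"
      by (intro sum.cong prob_succs_eq k) (auto dest: finite_subset)
    finally show ?thesis by (simp add: esym_def sum_distrib_left)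
  qed
  then have "(\<lambda>n. prob (?B n)) \<longlonglongrightarrow> succ_prob p i k" unfolding succ_prob_eq
    by (simp only:) (intro tendsto_intros esym_tendsto k)
  moreover have "incseq ?B"
    by (rule incseq_SucI) (auto simp: subset_iff intro: less_SucI)
  then have "(\<lambda>n. prob (?B n)) \<longlonglongrightarrow> prob (\<Union>n. ?B n)"
    using Bev by (intro finite_Lim_measure_incseq) auto
  moreover have "(\<Union>n. ?B n) = {\<omega>\<in>space M. finite (succs X k \<omega>) \<and> card (succs X k \<omega>) = i}"
  proof -
    have "finite (succs X k \<omega>) \<longleftrightarrow> (\<exists>n. succs X k \<omega> \<subseteq> {k..<n})" for \<omega>
    proof
      assume "finite (succs X k \<omega>)"
      then obtain n where "succs X k \<omega> \<subseteq> {..<n}" by (rule finite_nat_bounded[THEN exE])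
      then have "succs X k \<omega> \<subseteq> {k..<n}" by (force simp: succs_def)
      then show "\<exists>n. succs X k \<omega> \<subseteq> {k..<n}" ..
    qed (auto intro: finite_subset[of _ "{k..<_}"])
    then show ?thesis by auto
  qed
  ultimately show ?thesis by (simp only: LIMSEQ_unique)
qed

lemma prob_count_in:
  assumes k: "1 \<le> k" and I: "finite I"
  shows "prob {\<omega>\<in>space M. finite (succs X k \<omega>) \<and> card (succs X k \<omega>) \<in> I}
    = (\<Sum>i\<in>I. succ_prob p i k)"
proof -
  let ?C = "\<lambda>i. {\<omega>\<in>space M. finite (succs X k \<omega>) \<and> card (succs X k \<omega>) = i}"
  have "?C i \<in> events" for i
    using info_events[OF k count_info[of k "{i}"]] by simp
  then have "prob (\<Union>i\<in>I. ?C i) = (\<Sum>i\<in>I. prob (?C i))"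
    using I by (intro finite_measure_finite_Union) (auto simp: disjoint_family_on_def)
  moreover have "(\<Union>i\<in>I. ?C i)
      = {\<omega>\<in>space M. finite (succs X k \<omega>) \<and> card (succs X k \<omega>) \<in> I}" by auto
  ultimately show ?thesis by (simp add: prob_count_eq[OF k])
qed

section \<open>Stopping rules and the upper bound on their winning probability\<close>

text \<open>Moves the events decided by a stopping rule up to time \<open>n\<close> into the block
  to which \<open>indep_info\<close> applies.\<close>

lemma sets_filtration_le: "sets (trial_filtration M X (enat n)) \<subseteq> sets (info {1..n})"
proof -
  have "{\<omega>\<in>space M. X j \<omega>} \<in> sets (info {1..n})" if "1 \<le> j" "j \<le> n" for j
    using pred_info[of j "{1..n}"] that by (simp add: pred_def space_info)
  then have "{{\<omega>\<in>space M. X j \<omega>} | j. 1 \<le> j \<and> enat j \<le> enat n} \<subseteq> sets (info {1..n})"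
    by auto
  then have "sigma_sets (space M) {{\<omega>\<in>space M. X j \<omega>} | j. 1 \<le> j \<and> enat j \<le> enat n}
      \<subseteq> sets (info {1..n})"
    unfolding space_info[of "{1..n}", symmetric] by (rule sets.sigma_sets_subset)
  moreover have "sets (trial_filtration M X (enat n))
      = sigma_sets (space M) {{\<omega>\<in>space M. X j \<omega>} | j. 1 \<le> j \<and> enat j \<le> enat n}"
    unfolding trial_filtration_def by (rule sets_measure_of) auto
  ultimately show ?thesis by simp
qed

lemma space_filtration: "space (trial_filtration M X t) = space M"
  unfolding trial_filtration_def by (rule space_measure_of) auto

lemma first_success_from_stopping_rule:
  assumes k: "1 \<le> k"
  shows "first_success_from X k \<in> stopping_rules M X"
proof -
  have "Measurable.pred (trial_filtration M X t) (\<lambda>\<omega>. first_success_from X k \<omega> \<le> t)" for t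
  proof (cases t)
    case (enat n)
    have "Measurable.pred (trial_filtration M X t) (X j)" if "j \<in> {k..n}" for j
    proof -
      have "{\<omega>\<in>space M. X j \<omega>} \<in> {{\<omega>\<in>space M. X j \<omega>} | j. 1 \<le> j \<and> enat j \<le> t}"
        using that k enat by auto
      then have "{\<omega>\<in>space M. X j \<omega>} \<in> sets (trial_filtration M X t)"
        unfolding trial_filtration_def by (subst sets_measure_of) auto
      then show ?thesis by (simp add: pred_def space_filtration)
    qed
    then have "Measurable.pred (trial_filtration M X t) (\<lambda>\<omega>. \<exists>j\<in>{k..n}. X j \<omega>)"
      by (intro pred_intros_finite) auto
    then show ?thesis by (simp add: enat first_success_from_le_iff)
  qed (simp add: pred_def)
  then show ?thesis
    using k first_success_from_enatD[of X k]
    by (auto simp: stopping_rules_def stopping_time_def dest: order_trans)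
qed

lemma win_prob_first_success_from:
  assumes "1 \<le> l" "1 \<le> k"
  shows "win_prob M X l m (first_success_from X k) = u_val p m k l"
proof -
  have "(\<exists>n. first_success_from X k \<omega> = enat n \<and> finite (succs X n \<omega>)
      \<and> l \<le> card (succs X n \<omega>) \<and> card (succs X n \<omega>) \<le> m)
    \<longleftrightarrow> finite (succs X k \<omega>) \<and> card (succs X k \<omega>) \<in> {l..m}" for \<omega>
  proof
    assume *: "finite (succs X k \<omega>) \<and> card (succs X k \<omega>) \<in> {l..m}"
    \<comment> \<open>A count of at least \<open>l\<close>, which is positive, forces a success, so
      the rule does stop.\<close>
    then have "succs X k \<omega> \<noteq> {}" using assms by auto
    then obtain n where "first_success_from X k \<omega> = enat n" by (auto simp: first_success_from_eq)
    then show "\<exists>n. first_success_from X k \<omega> = enat n \<and> finite (succs X n \<omega>)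
      \<and> l \<le> card (succs X n \<omega>) \<and> card (succs X n \<omega>) \<le> m"
      using * first_success_from_enatD(3)[of X k \<omega> n] by auto
  qed (use first_success_from_enatD(3)[of X k \<omega>] in auto)
  then show ?thesis
    using prob_count_in[of k "{l..m}"] assms
    by (simp add: win_prob_def u_val_def flip: succs_def)
qed

lemma win_prob_le_opt_val:
  assumes lm: "1 \<le> l" "l \<le> m" and \<tau>: "\<tau> \<in> stopping_rules M X"
  shows "win_prob M X l m \<tau> \<le> opt_val l m 1"
proof -
  \<comment> \<open>Since the selected trial is itself a success, winning is a condition on the
    trials strictly after it, with the window lowered by one; this makes it independent of the
    decision to stop.\<close>
  let ?C = "\<lambda>n. {\<omega>\<in>space M. finite (succs X (Suc n) \<omega>) \<and> card (succs X (Suc n) \<omega>) \<in> {l - 1..m - 1}}"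
  let ?S = "\<lambda>n. {\<omega>\<in>space M. \<tau> \<omega> = enat n}"
  let ?R = "\<lambda>n. {\<omega>\<in>space M. enat n \<le> \<tau> \<omega>}"
  have \<tau>X: "1 \<le> n \<and> X n \<omega>" if "\<omega> \<in> space M" "\<tau> \<omega> = enat n" for n \<omega>
    using \<tau> that by (auto simp: stopping_rules_def)
  have le: "{\<omega>\<in>space M. \<tau> \<omega> \<le> enat n} \<in> sets (info {1..n})" for n
  proof -
    have "Measurable.pred (trial_filtration M X (enat n)) (\<lambda>\<omega>. \<tau> \<omega> \<le> enat n)"
      using \<tau> by (simp add: stopping_rules_def stopping_time_def)
    then show ?thesis using sets_filtration_le[of n] by (auto simp: pred_def space_filtration)
  qed
  \<comment> \<open>Not having stopped by time \<open>n\<close> is decided by the first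
    \<open>n\<close> trials, hence is independent of trial \<open>Suc n\<close>.\<close>
  have R: "?R (Suc n) \<in> sets (info {1..n})" for n
  proof -
    have "?R (Suc n) = space (info {1..n}) - {\<omega>\<in>space M. \<tau> \<omega> \<le> enat n}"
      by (auto simp: space_info not_le Suc_ile_eq)
    then show ?thesis using le[of n] by (metis sets.compl_sets)
  qed
  have R_ev: "?R (Suc n) \<in> events" for n
    using indep_info(1)[OF R[of n], of "{}"] by simp
  have S_info: "?S n \<in> sets (info {1..n})" if n: "1 \<le> n" for n
  proof -
    obtain n' where n': "n = Suc n'" using n by (cases n) auto
    have info_mono: "sets (info {1..n'}) \<subseteq> sets (info {1..n})"
      unfolding sets_info by (intro sigma_sets_mono' UN_mono) (auto simp: n')
    have "?S n = {\<omega>\<in>space M. \<tau> \<omega> \<le> enat n} \<inter> ?R (Suc n')" by (auto simp: n')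
    then show ?thesis using le[of n] R[of n'] info_mono by auto
  qed
  have S_ev: "?S n \<in> events" if "1 \<le> n" for n
    using indep_info(1)[OF S_info[OF that], of "{}"] by simp
  \<comment> \<open>Stopping times start at 1, so \<open>D n\<close> is the event of winning at time
    \<open>Suc n\<close>.\<close>
  define D where "D n = ?S (Suc n) \<inter> ?C (Suc n)" for n
  have D_ev: "D n \<in> events" for n
    unfolding D_def using S_ev[of "Suc n"] info_events[OF _ count_info[of "Suc (Suc n)" "{l - 1..m - 1}"]]
    by (intro sets.Int) auto
  have D_prob: "prob (D n) = prob (?S (Suc n)) * stop_val l m (Suc n)" for n
  proof -
    have "prob (D n) = prob (?S (Suc n)) * prob (?C (Suc n))"
      unfolding D_def by (intro indep_info(3)[OF S_info count_info]) simp
    also have "prob (?C (Suc n)) = (\<Sum>i=l - 1..m - 1. succ_prob p i (Suc (Suc n)))"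
      by (intro prob_count_in) auto
    also have "\<dots> = stop_val l m (Suc n)"
      unfolding stop_val_def using lm
      by (cases l; cases m) (simp_all add: sum.shift_bounds_cl_Suc_ivl del: sum.cl_ivl_Suc)
    finally show ?thesis .
  qed
  have "(\<exists>n. \<tau> \<omega> = enat n \<and> finite (succs X n \<omega>) \<and> l \<le> card (succs X n \<omega>)
      \<and> card (succs X n \<omega>) \<le> m) \<longleftrightarrow> (\<exists>n. \<omega> \<in> D n)" if \<omega>: "\<omega> \<in> space M" for \<omega>
  proof -
    have "finite (succs X n \<omega>) \<and> l \<le> card (succs X n \<omega>) \<and> card (succs X n \<omega>) \<le> m
        \<longleftrightarrow> \<omega> \<in> ?C n" if "\<tau> \<omega> = enat n" for n
    proof -
      have s: "succs X n \<omega> = insert n (succs X (Suc n) \<omega>)"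
        using \<tau>X[OF \<omega> that] by (intro succs_success) simp
      moreover have "n \<notin> succs X (Suc n) \<omega>" by (simp add: succs_def)
      \<comment> \<open>On finite sets the insertion raises the count by one; on infinite sets both
        sides fail.\<close>
      ultimately show ?thesis using \<omega> lm by (cases "finite (succs X (Suc n) \<omega>)") auto
    qed
    moreover have "\<exists>n'. n = Suc n'" if "\<tau> \<omega> = enat n" for n
      using \<tau>X[OF \<omega> that] by (cases n) auto
    ultimately show ?thesis unfolding D_def using \<omega> by (auto; metis)
  qed
  then have "{\<omega>\<in>space M. \<exists>n. \<tau> \<omega> = enat n \<and> finite (succs X n \<omega>) \<and> l \<le> card (succs X n \<omega>)
      \<and> card (succs X n \<omega>) \<le> m} = (\<Union>n. D n)"
    by (auto simp: D_def)
  then have win: "win_prob M X l m \<tau> = prob (\<Union>n. D n)"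
    by (simp add: win_prob_def flip: succs_def)
  \<comment> \<open>A supermartingale bound in integrated form: wins up to time \<open>N\<close>,
    plus the surviving mass valued by \<open>opt_val\<close>.\<close>
  have bound: "(\<Sum>n<N. prob (D n)) + prob (?R (Suc N)) * opt_val l m (Suc N) \<le> opt_val l m 1" for N
  proof (induction N)
    case 0
    have "enat (Suc 0) \<le> \<tau> \<omega>" if "\<omega> \<in> space M" for \<omega>
      using \<tau>X[OF that] by (cases "\<tau> \<omega>") auto
    then have "?R (Suc 0) = space M" by blast
    then show ?case by (simp add: prob_space)
  next
    case (Suc N)
    let ?q = "prob (?S (Suc N))"
    \<comment> \<open>Stopping requires survival and a success at this trial. Their independence
      gives the bound on \<open>q\<close> that \<open>opt_val_step\<close> asks for.\<close>
    have "?S (Suc N) \<subseteq> ?R (Suc N) \<inter> {\<omega>\<in>space M. X (Suc N) \<omega>}"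
      using \<tau>X by auto
    then have "?q \<le> prob (?R (Suc N) \<inter> {\<omega>\<in>space M. X (Suc N) \<omega>})"
      using R_ev X_event by (intro finite_measure_mono) auto
    also have "\<dots> = prob (?R (Suc N)) * p (Suc N)"
      using indep_info(3)[OF R[of N], of "{\<omega>\<in>space M. X (Suc N) \<omega>}"] pred_info[of "Suc N" "{Suc N..}"]
      by (simp add: pred_def space_info prob_X)
    finally have q: "?q \<le> prob (?R (Suc N)) * p (Suc N)" .
    have "?R (Suc (Suc N)) = ?R (Suc N) - ?S (Suc N)"
      by (auto simp: Suc_ile_eq order.strict_iff_order)
    then have "prob (?R (Suc (Suc N))) = prob (?R (Suc N)) - ?q"
      using R_ev S_ev[of "Suc N"] by (simp add: finite_measure_Diff subset_iff)
    then show ?case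
      using Suc opt_val_step[OF lm _ _ q] by (simp add: D_prob)
  qed
  have sums: "(\<lambda>n. prob (D n)) sums prob (\<Union>n. D n)"
    using D_ev by (intro finite_measure_UNION) (auto simp: disjoint_family_on_def D_def)
  have "(\<Sum>n<N. prob (D n)) \<le> opt_val l m 1" for N
  proof -
    have "0 \<le> prob (?R (Suc N)) * opt_val l m (Suc N)" by (simp add: opt_val_nonneg)
    then show ?thesis using bound[of N] by linarith
  qed
  then have "(\<Sum>n. prob (D n)) \<le> opt_val l m 1"
    using sums_summable[OF sums] by (intro suminf_le_const) auto
  then show ?thesis using sums_unique[OF sums] win by simp
qed

end

theorem theorem12:
  fixes M :: "'a measure" and X :: "nat \<Rightarrow> 'a \<Rightarrow> bool"
    and p :: "nat \<Rightarrow> real" and l m :: nat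
  assumes "1 \<le> l" and "l \<le> m"
    and "prob_space M"
    and "prob_space.indep_vars M (\<lambda>_. count_space UNIV) X {1..}"
    and "\<And>k. 1 \<le> k \<Longrightarrow> measure M {\<omega>\<in>space M. X k \<omega>} = p k"
    and "\<And>k. 1 \<le> k \<Longrightarrow> 0 \<le> p k \<and> p k < 1"
    and "summable (\<lambda>k. p (Suc k))"
  shows "(\<exists>\<tau>. optimal_rule M X l m \<tau>) \<and>
         threshold_set p l m \<noteq> {} \<and>
         optimal_rule M X l m (first_success_from X (opt_index p l m)) \<and>
         optimal_value M X l m = u_val p m (opt_index p l m) l"
proof -
  interpret bernoulli_trials M X p
    using assms by (auto simp: bernoulli_trials_def bernoulli_trials_axioms_def trial_probs_def)
  let ?k = "opt_index p l m"
  let ?\<tau> = "first_success_from X ?k"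
  have k: "1 \<le> ?k" using assms(1,2) by (rule opt_index_ge)
  have rule: "?\<tau> \<in> stopping_rules M X" using k by (rule first_success_from_stopping_rule)
  have val: "win_prob M X l m ?\<tau> = u_val p m ?k l"
    using assms(1) k by (rule win_prob_first_success_from)
  have le: "win_prob M X l m \<sigma> \<le> u_val p m ?k l" if "\<sigma> \<in> stopping_rules M X" for \<sigma>
    using win_prob_le_opt_val[OF assms(1,2) that] k by (simp add: opt_val_def max_absorb2)
  have opt: "optimal_rule M X l m ?\<tau>"
    using rule le by (simp add: optimal_rule_def val)
  have "optimal_value M X l m = u_val p m ?k l"
    unfolding optimal_value_def
    by (rule cSup_eq_maximum) (use rule val le in \<open>auto simp: image_iff intro!: bexI[of _ ?\<tau>]\<close>)
  then show ?thesis
    using opt threshold_set_nonempty[OF assms(1,2)] by blast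
qed

end
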